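(* Let $L\ge1$ be an integer and let $0\le s_a<s_v<1$. In protocol P1 (the BB84 quantum digital signature protocol with random exchange of signature elements, described in the context), suppose Bob and Charlie are honest and Alice is arbitrary: she may send any joint quantum state $\rho_{bc}$ of the $2L$ qubits (including entangled states) to Bob and Charlie, and later any declaration. Then the probability that Alice repudiates, i.e. that her declaration is accepted by Bob and, when forwarded, is rejected by Charlie, satisfies $$p({\rm rep})\le \exp\!\left(-\frac{(s_v-s_a)^2L}{2}\right).$$
   Context: The BB84 states are $|0\rangle,\ |1\rangle,\ |\pm\rangle=\frac{1}{\sqrt2}(|0\rangle\pm|1\rangle)$. All channels (classical and quantum, between all pairs of parties) are ideal and authenticated: what is sent is received by the intended recipient, untampered. USE (unambiguous state elimination) measurement: one picks the basis $\{|0\rangle,|1\rangle\}$ or $\{|+\rangle,|-\rangle\}$ uniformly at random (independently of everything else), measures the qubit in it, and rules out the BB84 state orthogonal to the outcome. Protocol P1 (for one fixed possible message). Distribution stage: Alice sends $L$ qubits $b_1,\dots,b_L$ to Bob and $L$ qubits $c_1,\dots,c_L$ to Charlie (an honest Alice sends two copies of the same sequence of random BB84 states). Each of Bob and Charlie, independently for each of the qubits received from Alice, either keeps it or forwards it to the other, with probability $1/2$ each, unknown to Alice. Each then makes a USE measurement on every qubit he ends up holding (kept or received from the other recipient) and records the excluded state and the position. Messaging stage: Alice sends a declaration, i.e. a list of $L$ BB84 states, one per position $l=1,\dots,L$. A qubit ($b_l$ or $c_l$) gives a mismatch if the state declared for position $l$ is the state excluded by the USE measurement on that qubit. A recipient's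 number of mismatches is the number of qubits he measured that give a mismatch. Bob accepts if his number of mismatches is less than $s_aL$; Charlie accepts a forwarded declaration if his number of mismatches is less than $s_vL$, and rejects otherwise. (The parties may also abort if the number of forwarded elements is atypical; an abort does not count as repudiation.) *)

theory Defs
  imports "HOL-Probability.Probability" "HOL-Library.Monad_Syntax"
begin

section \<open>Finite-dimensional quantum mechanics\<close>

text \<open>
  Operators on the Hilbert space with orthonormal basis \<^typ>\<open>'n\<close> are matrices indexed by \<^typ>\<open>'n\<close>.
  A system with basis \<^typ>\<open>'m\<close> and a system with basis \<^typ>\<open>'n\<close> jointly have basis \<^typ>\<open>'m \<times> 'n\<close>;
  a family of qubits with labels \<^typ>\<open>'q\<close> has the bit assignments \<^typ>\<open>'q \<Rightarrow> bool\<close> as its basis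
  (\<^const>\<open>False\<close> for 0, \<^const>\<open>True\<close> for 1).
\<close>

definition dagger :: "complex ^ 'n ^ 'm \<Rightarrow> complex ^ 'm ^ 'n" where
  "dagger A = (\<chi> i j. cnj (A $ j $ i))"

definition outer :: "complex ^ 'n \<Rightarrow> complex ^ 'n ^ 'n" where
  "outer v = (\<chi> i j. v $ i * cnj (v $ j))"

definition tensor_op ::
    "complex ^ 'm ^ 'm \<Rightarrow> complex ^ 'n ^ 'n \<Rightarrow> complex ^ ('m \<times> 'n) ^ ('m \<times> 'n)" where
  "tensor_op A B = (\<chi> i j. A $ fst i $ fst j * B $ snd i $ snd j)"

definition tensor_ket :: "('q::finite \<Rightarrow> complex ^ bool) \<Rightarrow> complex ^ ('q \<Rightarrow> bool)" where
  "tensor_ket \<psi> = (\<chi> x. \<Prod>q\<in>UNIV. \<psi> q $ x q)"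

definition positive_operator :: "complex ^ 'n ^ 'n \<Rightarrow> bool" where
  "positive_operator A \<longleftrightarrow>
     dagger A = A \<and> (\<forall>v. 0 \<le> Re (\<Sum>i\<in>UNIV. \<Sum>j\<in>UNIV. cnj (v $ i) * A $ i $ j * v $ j))"

definition density_operator :: "complex ^ 'n ^ 'n \<Rightarrow> bool" where
  "density_operator \<rho> \<longleftrightarrow> positive_operator \<rho> \<and> trace \<rho> = 1"

text \<open>
  A general quantum measurement with outcomes \<^typ>\<open>'o\<close> is given by measurement operators
  \<open>K o\<close> with \<open>\<Sum>o. (K o)\<^sup>\<dagger> (K o) = I\<close>; every POVM arises in this way.
\<close>

definition measurement :: "('o::finite \<Rightarrow> complex ^ 'n ^ 'n) \<Rightarrow> bool" where
  "measurement K \<longleftrightarrow> (\<Sum>a\<in>UNIV. dagger (K a) ** K a) = mat 1"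

definition born :: "('o \<Rightarrow> complex ^ 'n ^ 'n) \<Rightarrow> complex ^ 'n ^ 'n \<Rightarrow> 'o pmf" where
  "born K \<rho> = embed_pmf (\<lambda>a. Re (trace (K a ** \<rho> ** dagger (K a))))"

lemma trace_conj_sum:
  "trace (A ** \<rho> ** dagger A) =
     (\<Sum>k\<in>UNIV. \<Sum>i\<in>UNIV. \<Sum>j\<in>UNIV. A $ k $ i * \<rho> $ i $ j * cnj (A $ k $ j))"
  by (simp add: trace_def matrix_matrix_mult_def dagger_def sum_distrib_right)
     (intro sum.cong refl sum.swap)

text \<open>For a state and a measurement, \<^const>\<open>born\<close> is indeed the distribution given by the Born rule.\<close>

lemma born_nonneg:
  assumes "density_operator \<rho>"
  shows "0 \<le> Re (trace (A ** \<rho> ** dagger A))"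
proof -
  have *: "0 \<le> Re (\<Sum>i\<in>UNIV. \<Sum>j\<in>UNIV. A $ k $ i * \<rho> $ i $ j * cnj (A $ k $ j))" for k
  proof -
    have "0 \<le> Re (\<Sum>i\<in>UNIV. \<Sum>j\<in>UNIV.
        cnj ((\<chi> i. cnj (A $ k $ i)) $ i) * \<rho> $ i $ j * (\<chi> i. cnj (A $ k $ i)) $ j)"
      using assms unfolding density_operator_def positive_operator_def by blast
    then show ?thesis by simp
  qed
  then show ?thesis
    unfolding trace_conj_sum by (subst Re_sum) (rule sum_nonneg, rule *)
qed

lemma born_sum:
  fixes K :: "'o::finite \<Rightarrow> complex ^ 'n ^ 'n"
  assumes "density_operator \<rho>" "measurement K"
  shows "(\<Sum>a\<in>UNIV. trace (K a ** \<rho> ** dagger (K a))) = 1"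
proof -
  have "trace (K a ** \<rho> ** dagger (K a)) = trace ((dagger (K a) ** K a) ** \<rho>)" for a
    by (metis matrix_mul_assoc trace_mul_sym)
  then have "(\<Sum>a\<in>UNIV. trace (K a ** \<rho> ** dagger (K a)))
      = (\<Sum>a\<in>UNIV. trace ((dagger (K a) ** K a) ** \<rho>))" by simp
  also have "\<dots> = trace ((\<Sum>a\<in>UNIV. dagger (K a) ** K a) ** \<rho>)"
  proof -
    have "trace ((\<Sum>a\<in>S. f a) ** \<rho>) = (\<Sum>a\<in>S. trace (f a ** \<rho>))"
      if "finite S" for S :: "'o set" and f :: "'o \<Rightarrow> complex ^ 'n ^ 'n"
      using that
      by (induction S rule: finite_induct)
         (simp_all add: trace_def matrix_matrix_mult_def sum.distrib distrib_right)
    then show ?thesis by simp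
  qed
  also have "\<dots> = 1"
    using assms by (simp add: measurement_def density_operator_def)
  finally show ?thesis .
qed

lemma pmf_born:
  fixes K :: "'o::finite \<Rightarrow> complex ^ 'n ^ 'n"
  assumes "density_operator \<rho>" "measurement K"
  shows "pmf (born K \<rho>) a = Re (trace (K a ** \<rho> ** dagger (K a)))"
  unfolding born_def
proof (rule pmf_embed_pmf)
  show "(\<integral>\<^sup>+ x. ennreal (Re (trace (K x ** \<rho> ** dagger (K x)))) \<partial>count_space UNIV) = 1"
    by (simp add: nn_integral_count_space_finite sum_ennreal[OF born_nonneg[OF assms(1)]]
        born_sum[OF assms] del: Re_sum flip: Re_sum)
qed (rule born_nonneg[OF assms(1)])


section \<open>BB84 states and the USE measurement\<close>

datatype bb84 = Zero | One | Plus | Minus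

instance bb84 :: finite
proof
  have "UNIV = {Zero, One, Plus, Minus}" using bb84.exhaust by blast
  then show "finite (UNIV :: bb84 set)" by (metis finite.emptyI finite.insertI)
qed

fun ket :: "bb84 \<Rightarrow> complex ^ bool" where
  "ket Zero = axis False 1"
| "ket One = axis True 1"
| "ket Plus = (1 / sqrt 2) *\<^sub>R (axis False 1 + axis True 1)"
| "ket Minus = (1 / sqrt 2) *\<^sub>R (axis False 1 - axis True 1)"

datatype basis = Computational | Diagonal

instance basis :: finite
proof
  have "UNIV = {Computational, Diagonal}" using basis.exhaust by blast
  then show "finite (UNIV :: basis set)" by (metis finite.emptyI finite.insertI)
qed

fun basis_state :: "basis \<Rightarrow> bool \<Rightarrow> bb84" where
  "basis_state Computational False = Zero"
| "basis_state Computational True = One"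
| "basis_state Diagonal False = Plus"
| "basis_state Diagonal True = Minus"

fun orthogonal_state :: "bb84 \<Rightarrow> bb84" where
  "orthogonal_state Zero = One"
| "orthogonal_state One = Zero"
| "orthogonal_state Plus = Minus"
| "orthogonal_state Minus = Plus"

definition excluded_state :: "basis \<Rightarrow> bool \<Rightarrow> bb84" where
  "excluded_state b x = orthogonal_state (basis_state b x)"

lemma orthogonal_state_iff:
  "t = orthogonal_state s \<longleftrightarrow> (\<Sum>x\<in>UNIV. cnj (ket s $ x) * ket t $ x) = 0"
  by (cases s; cases t) (simp_all add: UNIV_bool axis_def complex_eq_iff)


section \<open>Protocol P1\<close>

datatype recipient = Bob | Charlie

instance recipient :: finite
proof
  have "UNIV = {Bob, Charlie}" using recipient.exhaust by blast
  then show "finite (UNIV :: recipient set)" by (metis finite.emptyI finite.insertI)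
qed

fun other :: "recipient \<Rightarrow> recipient" where
  "other Bob = Charlie"
| "other Charlie = Bob"

text \<open>
  The \<open>L\<close> positions are the elements of a finite type \<^typ>\<open>'l\<close>, so \<open>L = CARD('l)\<close>.
  The label \<open>(l, r)\<close> is the qubit of position \<open>l\<close> that Alice sends to \<open>r\<close>: \<open>b\<^sub>l\<close> is
  \<open>(l, Bob)\<close> and \<open>c\<^sub>l\<close> is \<open>(l, Charlie)\<close>.
\<close>

type_synonym 'l qubit = "'l \<times> recipient"

type_synonym 'l qubits_basis = "'l qubit \<Rightarrow> bool"

type_synonym 'l bb84_declaration = "'l \<Rightarrow> bb84"

definition qubits_projector ::
    "('l::finite qubit \<Rightarrow> basis) \<Rightarrow> ('l qubit \<Rightarrow> bool) \<Rightarrow> complex ^ 'l qubits_basis ^ 'l qubits_basis" where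
  "qubits_projector \<beta> x = outer (tensor_ket (\<lambda>q. ket (basis_state (\<beta> q) (x q))))"

text \<open>
  A dishonest Alice keeps a register with basis \<^typ>\<open>'a\<close>, possibly entangled with the qubits she
  sends, and obtains her declaration by measuring it with operators \<open>K\<close>. A fixed declaration for a
  state of the \<open>2L\<close> qubits alone is the case of a one-dimensional register. As the measurements of
  Alice, Bob and Charlie act on different subsystems, their time order is irrelevant for the joint
  distribution of the outcomes.
\<close>

definition joint_measurement ::
    "('l::finite bb84_declaration \<Rightarrow> complex ^ 'a ^ 'a) \<Rightarrow> ('l qubit \<Rightarrow> basis) \<Rightarrow>
     'l bb84_declaration \<times> ('l qubit \<Rightarrow> bool) \<Rightarrow>
     complex ^ ('a \<times> 'l qubits_basis) ^ ('a \<times> 'l qubits_basis)" where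
  "joint_measurement K \<beta> = (\<lambda>(d, x). tensor_op (K d) (qubits_projector \<beta> x))"

lemma ket_basis_complete:
  "(\<Sum>x\<in>UNIV. ket (basis_state b x) $ i * cnj (ket (basis_state b x) $ j)) = (if i = j then 1 else 0)"
  by (cases b; cases i; cases j) (simp_all add: UNIV_bool axis_def complex_eq_iff)

lemma ket_norm: "(\<Sum>x\<in>UNIV. ket s $ x * cnj (ket s $ x)) = 1"
  by (cases s) (simp_all add: UNIV_bool axis_def complex_eq_iff)

lemma sum_fun_prod:
  fixes f :: "'q::finite \<Rightarrow> 'b::finite \<Rightarrow> complex"
  shows "(\<Sum>g\<in>UNIV. \<Prod>q\<in>UNIV. f q (g q)) = (\<Prod>q\<in>UNIV. \<Sum>b\<in>UNIV. f q b)"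
  using prod_sum_PiE[of UNIV "\<lambda>_. UNIV" f] by (simp add: PiE_UNIV_domain)

lemma measurement_qubits_projector: "measurement (qubits_projector \<beta>)"
proof -
  let ?v = "\<lambda>x. tensor_ket (\<lambda>q. ket (basis_state (\<beta> q) (x q)))"
  have norm: "(\<Sum>z\<in>UNIV. ?v x $ z * cnj (?v x $ z)) = 1" for x
    by (simp add: tensor_ket_def prod.distrib[symmetric] ket_norm
        sum_fun_prod[where f = "\<lambda>q b. ket (basis_state (\<beta> q) (x q)) $ b * cnj (ket (basis_state (\<beta> q) (x q)) $ b)"])
  have "(dagger (qubits_projector \<beta> x) ** qubits_projector \<beta> x) $ i $ j = ?v x $ i * cnj (?v x $ j)"
    for x i j
  proof -
    have "(dagger (qubits_projector \<beta> x) ** qubits_projector \<beta> x) $ i $ j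
        = (\<Sum>z\<in>UNIV. (?v x $ i * cnj (?v x $ j)) * (?v x $ z * cnj (?v x $ z)))"
      by (simp add: qubits_projector_def dagger_def outer_def matrix_matrix_mult_def mult_ac)
    then show ?thesis by (simp only: sum_distrib_left[symmetric] norm mult_1_right)
  qed
  moreover have "(\<Sum>x\<in>UNIV. ?v x $ i * cnj (?v x $ j)) = (if i = j then 1 else 0)" for i j
  proof -
    have "(\<Sum>x\<in>UNIV. ?v x $ i * cnj (?v x $ j)) = (\<Prod>q\<in>UNIV. if i q = j q then 1 else 0)"
      by (simp add: tensor_ket_def prod.distrib[symmetric]
            sum_fun_prod[where f = "\<lambda>q b. ket (basis_state (\<beta> q) b) $ i q * cnj (ket (basis_state (\<beta> q) b) $ j q)"]
            ket_basis_complete)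
    also have "\<dots> = (if i = j then 1 else 0)"
      by (cases "i = j") (simp, force)
    finally show ?thesis .
  qed
  ultimately show ?thesis
    by (simp add: measurement_def vec_eq_iff mat_def)
qed

lemma tensor_op_mult: "tensor_op A B ** tensor_op C D = tensor_op (A ** C) (B ** D)"
  by (simp add: tensor_op_def matrix_matrix_mult_def vec_eq_iff sum_product
        sum.cartesian_product UNIV_Times_UNIV[symmetric] case_prod_beta mult_ac del: UNIV_Times_UNIV)

lemma measurement_joint:
  fixes K :: "'l::finite bb84_declaration \<Rightarrow> complex ^ 'a ^ 'a"
  assumes "measurement K"
  shows "measurement (joint_measurement K \<beta>)"
proof -
  let ?P = "qubits_projector \<beta>"
  have dagger: "dagger (tensor_op A B) = tensor_op (dagger A) (dagger B)"
    for A :: "complex ^ 'a ^ 'a" and B :: "complex ^ 'l qubits_basis ^ 'l qubits_basis"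
    by (simp add: dagger_def tensor_op_def vec_eq_iff)
  have "(\<Sum>(d, x)\<in>UNIV. tensor_op (dagger (K d) ** K d) (dagger (?P x) ** ?P x))
      = tensor_op (\<Sum>d\<in>UNIV. dagger (K d) ** K d) (\<Sum>x\<in>UNIV. dagger (?P x) ** ?P x)"
    by (simp add: tensor_op_def vec_eq_iff sum_product
        sum.cartesian_product UNIV_Times_UNIV[symmetric] case_prod_beta del: UNIV_Times_UNIV)
  also have "\<dots> = mat 1"
    using assms measurement_qubits_projector[of \<beta>]
    by (auto simp: measurement_def tensor_op_def mat_def vec_eq_iff prod_eq_iff)
  finally show ?thesis
    by (simp add: measurement_def joint_measurement_def case_prod_beta dagger tensor_op_mult)
qed

datatype 'l transcript = Transcript
  (forwarded: "'l qubit \<Rightarrow> bool")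
  (excluded: "'l qubit \<Rightarrow> bb84")
  (declared: "'l bb84_declaration")

text \<open>
  The uniform distribution on a function space makes the individual choices independent and uniform.
\<close>

definition P1 ::
    "complex ^ ('a \<times> 'l qubits_basis) ^ ('a \<times> 'l::finite qubits_basis) \<Rightarrow>
     ('l bb84_declaration \<Rightarrow> complex ^ 'a ^ 'a) \<Rightarrow> 'l transcript pmf" where
  "P1 \<rho> K = do {
     f \<leftarrow> pmf_of_set (UNIV :: ('l qubit \<Rightarrow> bool) set);
     \<beta> \<leftarrow> pmf_of_set (UNIV :: ('l qubit \<Rightarrow> basis) set);
     (d, x) \<leftarrow> born (joint_measurement K \<beta>) \<rho>;
     return_pmf (Transcript f (\<lambda>q. excluded_state (\<beta> q) (x q)) d)
   }"

definition holder :: "'l transcript \<Rightarrow> 'l qubit \<Rightarrow> recipient" where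
  "holder t q = (if forwarded t q then other (snd q) else snd q)"

definition mismatch :: "'l transcript \<Rightarrow> 'l qubit \<Rightarrow> bool" where
  "mismatch t q \<longleftrightarrow> declared t (fst q) = excluded t q"

definition mismatches :: "'l transcript \<Rightarrow> recipient \<Rightarrow> nat" where
  "mismatches t r = card {q. holder t q = r \<and> mismatch t q}"

definition accepts :: "real \<Rightarrow> 'l transcript \<Rightarrow> recipient \<Rightarrow> bool" where
  "accepts s t r \<longleftrightarrow> real (mismatches t r) < s * CARD('l)"

definition num_forwarded :: "'l transcript \<Rightarrow> recipient \<Rightarrow> nat" where
  "num_forwarded t r = card {l. forwarded t (l, r)}"

text \<open>
  \<open>abort m n\<close> tells whether the parties abort when Bob forwards \<open>m\<close> and Charlie \<open>n\<close> elements;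
  \<open>abort = (\<lambda>m n. False)\<close> is the protocol without aborts.
\<close>

definition repudiation :: "(nat \<Rightarrow> nat \<Rightarrow> bool) \<Rightarrow> real \<Rightarrow> real \<Rightarrow> 'l transcript \<Rightarrow> bool" where
  "repudiation abort s\<^sub>a s\<^sub>v t \<longleftrightarrow>
     \<not> abort (num_forwarded t Bob) (num_forwarded t Charlie) \<and>
     accepts s\<^sub>a t Bob \<and> \<not> accepts s\<^sub>v t Charlie"

end

theory Submission
  imports Defs
begin

(* Let B and C be the numbers of mismatches of Bob and Charlie. Repudiation forces
   C - B > (s_v - s_a) L, which is treated by the exponential moment method. Two independent
   sources of randomness are beyond Alice's control. The random exchange makes every mismatch
   contribute +1 or -1 to C - B with probability 1/2 each. Moreover, a mismatch on a qubit requires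
   that its USE basis is that of the declared state; by no-signalling the declaration is independent
   of the bases, so this has probability 1/2. Hence
   E exp(t (C - B)) <= ((1 + cosh t) / 2)^(2L) = cosh(t/2)^(4L) <= exp(t^2 L / 2),
   and t = s_v - s_a gives the bound. The random exchange alone would only give
   exp(-(s_v - s_a)^2 L / 4). *)

section \<open>Sums over functions and bounds on cosh\<close>

lemma sum_fun_prod_comm:
  fixes g :: "'q::finite \<Rightarrow> 'b::finite \<Rightarrow> 'c::comm_semiring_1"
  shows "(\<Sum>f\<in>UNIV. \<Prod>q\<in>UNIV. g q (f q)) = (\<Prod>q\<in>UNIV. \<Sum>b\<in>UNIV. g q b)"
  using prod_sum_PiE[of UNIV "\<lambda>_. UNIV" g] by (simp add: PiE_UNIV_domain)

text \<open>\<open>cosh x\<close> is the moment generating function of a fair sign, so this is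
  Hoeffding's lemma for a two-point variable.\<close>

lemma cosh_le_exp_square:
  fixes x :: real
  shows "cosh x \<le> exp (x\<^sup>2 / 2)"
proof -
  \<comment> \<open>The range \<open>h\<close> of the two-point variable must be nonnegative; cosh
    is even, so the absolute value costs nothing.\<close>
  define h where "h = 2 * \<bar>x\<bar>"
  have "- h * (1/2) + ln (1 + (1/2) * (exp h - 1)) \<le> h\<^sup>2 / 8"
    by (rule Hoeffdings_lemma_aux) (simp_all add: h_def)
  then have "ln ((1 + exp h) / 2) \<le> h\<^sup>2 / 8 + h / 2"
    by (simp add: field_simps)
  then have "(1 + exp h) / 2 \<le> exp (h\<^sup>2 / 8 + h / 2)"
    by (subst (asm) exp_le_cancel_iff[symmetric]) (simp add: add_pos_pos)
  \<comment> \<open>This factor shifts the values 0 and \<open>h\<close> to the symmetric pair of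
    \<open>- h / 2\<close> and \<open>h / 2\<close>.\<close>
  then have "(1 + exp h) / 2 * exp (- h / 2) \<le> exp (h\<^sup>2 / 8 + h / 2) * exp (- h / 2)"
    by (rule mult_right_mono) simp
  also have "\<dots> = exp (h\<^sup>2 / 8)"
    by (simp flip: exp_add)
  also have "(1 + exp h) / 2 * exp (- h / 2) = cosh (h / 2)"
    by (simp add: cosh_field_def field_simps flip: exp_add)
  finally show ?thesis
    by (simp add: h_def power_mult_distrib)
qed

text \<open>Averaging cosh with 1 gives the square of cosh at half the argument, so the exponent is
  half that of \<open>cosh_le_exp_square\<close>.\<close>

lemma cosh_plus_1_le:
  fixes x :: real
  shows "cosh x + 1 \<le> 2 * exp (x\<^sup>2 / 4)"
proof -
  have "cosh x + 1 = 2 * (cosh (x / 2))\<^sup>2"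
    using cosh_double_cosh[of "x / 2"] by simp
  also have "\<dots> \<le> 2 * (exp ((x / 2)\<^sup>2 / 2))\<^sup>2"
    by (intro mult_left_mono power_mono cosh_le_exp_square) (simp_all add: cosh_real_nonneg)
  also have "\<dots> = 2 * exp (x\<^sup>2 / 4)"
    by (simp add: power_divide flip: exp_of_nat_mult)
  finally show ?thesis .
qed

section \<open>Operator identities and the marginal of the declaration\<close>

lemma UNIV_basis: "UNIV = {Computational, Diagonal}"
  using basis.exhaust by blast

lemma UNIV_recipient: "UNIV = {Bob, Charlie}"
  using recipient.exhaust by blast

lemma card_basis: "CARD(basis) = 2"
  by (simp add: UNIV_basis)

lemma card_qubit: "CARD('l::finite qubit) = 2 * CARD('l)"
  by (simp add: card_cartesian_product UNIV_recipient flip: UNIV_Times_UNIV)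

lemma dagger_tensor_op: "dagger (tensor_op A B) = tensor_op (dagger A) (dagger B)"
  by (simp add: dagger_def tensor_op_def vec_eq_iff)

lemma trace_sum_mult:
  fixes F :: "'i \<Rightarrow> complex ^ 'n ^ 'n"
  shows "(\<Sum>a\<in>S. trace (F a ** \<rho>)) = trace ((\<Sum>a\<in>S. F a) ** \<rho>)"
  by (induction S rule: infinite_finite_induct)
     (simp_all add: trace_def matrix_matrix_mult_def sum.distrib distrib_right)

lemma tensor_op_sum_right: "tensor_op A (\<Sum>x\<in>S. F x) = (\<Sum>x\<in>S. tensor_op A (F x))"
  by (simp add: tensor_op_def vec_eq_iff sum_distrib_left)

text \<open>No-signalling: the distribution of Alice's declaration does not depend on the bases \<open>\<beta>\<close>.\<close>

lemma declaration_marginal: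
  fixes \<rho> :: "complex ^ ('a::finite \<times> 'l::finite qubits_basis) ^ ('a \<times> 'l qubits_basis)"
    and K :: "'l bb84_declaration \<Rightarrow> complex ^ 'a ^ 'a"
  assumes "density_operator \<rho>" "measurement K"
  shows "(\<Sum>x\<in>UNIV. pmf (born (joint_measurement K \<beta>) \<rho>) (d, x))
           = Re (trace (tensor_op (dagger (K d) ** K d) (mat 1) ** \<rho>))"
proof -
  let ?P = "qubits_projector \<beta>" and ?J = "joint_measurement K \<beta>"
  have "pmf (born ?J \<rho>) (d, x)
      = Re (trace (tensor_op (dagger (K d) ** K d) (dagger (?P x) ** ?P x) ** \<rho>))" for x
  proof -
    have "trace (?J (d, x) ** \<rho> ** dagger (?J (d, x)))
        = trace ((dagger (?J (d, x)) ** ?J (d, x)) ** \<rho>)"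
      by (metis matrix_mul_assoc trace_mul_sym)
    then show ?thesis
      by (subst pmf_born[OF assms(1) measurement_joint[OF assms(2)]])
         (simp add: joint_measurement_def dagger_tensor_op tensor_op_mult)
  qed
  \<comment> \<open>Completeness removes the recipients' outcomes, and with them
    \<open>\<beta>\<close>.\<close>
  moreover have "(\<Sum>x\<in>UNIV. dagger (?P x) ** ?P x) = mat 1"
    using measurement_qubits_projector unfolding measurement_def .
  ultimately show ?thesis
    by (simp add: trace_sum_mult tensor_op_sum_right[symmetric] flip: Re_sum)
qed

section \<open>Mismatches and their exponential moments\<close>

fun basis_of :: "bb84 \<Rightarrow> basis" where
  "basis_of Zero = Computational"
| "basis_of One = Computational"
| "basis_of Plus = Diagonal"
| "basis_of Minus = Diagonal"

text \<open>Orthogonal BB84 states share a basis. Hence a mismatch forces the measured basis to be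
  that of the declared state, whatever the outcome.\<close>

lemma basis_of_excluded_state: "basis_of (excluded_state b x) = b"
  by (cases b; cases x) (simp_all add: excluded_state_def)

text \<open>One signed term per qubit, so that the exponential factorises over the qubits.\<close>

definition score :: "'l::finite transcript \<Rightarrow> real" where
  "score t = (\<Sum>q\<in>UNIV. if mismatch t q then if holder t q = Charlie then 1 else - 1 else 0)"

lemma score_eq: "score t = real (mismatches t Charlie) - real (mismatches t Bob)"
proof -
  have m: "real (mismatches t r) = (\<Sum>q\<in>UNIV. if holder t q = r \<and> mismatch t q then 1 else 0)" for r
    by (simp add: mismatches_def sum.If_cases)
  show ?thesis
    unfolding m score_def sum_subtractf[symmetric]
    using recipient.exhaust by (intro sum.cong) auto
qed

lemma repudiation_score:
  fixes t :: "'l::finite transcript"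
  assumes "repudiation abort s\<^sub>a s\<^sub>v t"
  shows "(s\<^sub>v - s\<^sub>a) * CARD('l) \<le> score t"
  using assms unfolding repudiation_def accepts_def score_eq by (simp add: algebra_simps)

text \<open>For fixed \<open>M\<close> and \<open>d\<close>, the two forwarding choices of a
  mismatching qubit give the signs 1 and -1 in some order, hence \<open>exp s + exp (- s)\<close>;
  any other qubit gives 1 + 1.\<close>

lemma score_exchange_moment:
  fixes M :: "'l::finite qubit \<Rightarrow> bb84" and d :: "'l bb84_declaration"
  shows "(\<Sum>f\<in>UNIV. exp (s * score (Transcript f M d)))
           = (\<Prod>q\<in>UNIV. 2 * (if d (fst q) = M q then cosh s else 1))"
proof -
  define g :: "'l qubit \<Rightarrow> bool \<Rightarrow> real" where
    "g q b = exp (s * (if d (fst q) = M q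
       then if (if b then other (snd q) else snd q) = Charlie then 1 else - 1 else 0))" for q b
  have "exp (s * score (Transcript f M d)) = (\<Prod>q\<in>UNIV. g q (f q))" for f
    unfolding score_def holder_def mismatch_def g_def transcript.sel by (simp add: sum_distrib_left exp_sum)
  then have "(\<Sum>f\<in>UNIV. exp (s * score (Transcript f M d))) = (\<Prod>q\<in>UNIV. \<Sum>b\<in>UNIV. g q b)"
    by (simp add: sum_fun_prod_comm)
  moreover have "(\<Sum>b\<in>UNIV. g q b) = 2 * (if d (fst q) = M q then cosh s else 1)" for q
    by (cases "snd q") (simp_all add: UNIV_bool g_def cosh_field_def)
  ultimately show ?thesis by simp
qed

lemma basis_choice_moment:
  fixes c :: "'q::finite \<Rightarrow> basis" and a :: real
  shows "(\<Sum>\<beta>\<in>UNIV. \<Prod>q\<in>UNIV. if \<beta> q = c q then a else 1) = (a + 1) ^ CARD('q)"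
proof -
  have "(\<Sum>b\<in>UNIV. if b = c q then a else 1) = a + 1" for q
    by (cases "c q") (simp_all add: UNIV_basis)
  then show ?thesis
    by (simp add: sum_fun_prod_comm[of "\<lambda>q b. if b = c q then a else 1"])
qed

section \<open>Probabilities in the protocol as finite sums\<close>

lemma prob_bind_pmf_of_set:
  fixes N :: "'i::finite \<Rightarrow> 'b pmf"
  shows "measure_pmf.prob (bind_pmf (pmf_of_set UNIV) N) A
           = (\<Sum>i\<in>UNIV. measure_pmf.prob (N i) A) / CARD('i)"
proof -
  have "ennreal (measure_pmf.prob (bind_pmf (pmf_of_set UNIV) N) A)
      = (\<integral>\<^sup>+i. ennreal (measure_pmf.prob (N i) A) \<partial>pmf_of_set UNIV)"
    by (simp flip: measure_pmf.emeasure_eq_measure)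
  also have "\<dots> = ennreal (\<integral>i. measure_pmf.prob (N i) A \<partial>pmf_of_set UNIV)"
    by (intro nn_integral_eq_integral) (auto intro: integrable_measure_pmf_finite)
  also have "\<dots> = ennreal ((\<Sum>i\<in>UNIV. measure_pmf.prob (N i) A) / CARD('i))"
    by (simp add: integral_pmf_of_set)
  finally show ?thesis
    by (simp add: sum_nonneg)
qed

lemma prob_P1:
  fixes \<rho> :: "complex ^ ('a::finite \<times> 'l::finite qubits_basis) ^ ('a \<times> 'l qubits_basis)"
    and K :: "'l bb84_declaration \<Rightarrow> complex ^ 'a ^ 'a"
  shows "measure_pmf.prob (P1 \<rho> K) A
     = (\<Sum>f\<in>UNIV. \<Sum>\<beta>\<in>UNIV. \<Sum>d\<in>UNIV. \<Sum>x\<in>UNIV. pmf (born (joint_measurement K \<beta>) \<rho>) (d, x) *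
          indicator A (Transcript f (\<lambda>q. excluded_state (\<beta> q) (x q)) d)) / 4 ^ CARD('l qubit)"
proof -
  have inner: "measure_pmf.prob
        (bind_pmf (born (joint_measurement K \<beta>) \<rho>)
          (\<lambda>(d, x). return_pmf (Transcript f (\<lambda>q. excluded_state (\<beta> q) (x q)) d))) A
      = (\<Sum>d\<in>UNIV. \<Sum>x\<in>UNIV. pmf (born (joint_measurement K \<beta>) \<rho>) (d, x) *
          indicator A (Transcript f (\<lambda>q. excluded_state (\<beta> q) (x q)) d))" for f \<beta>
  proof -
    let ?h = "\<lambda>(d, x). Transcript f (\<lambda>q. excluded_state (\<beta> q) (x q)) d"
    let ?p = "born (joint_measurement K \<beta>) \<rho>"
    have "bind_pmf ?p (\<lambda>(d, x). return_pmf (Transcript f (\<lambda>q. excluded_state (\<beta> q) (x q)) d))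
        = map_pmf ?h ?p"
      by (simp add: map_pmf_def case_prod_unfold)
    then have "measure_pmf.prob (bind_pmf ?p
          (\<lambda>(d, x). return_pmf (Transcript f (\<lambda>q. excluded_state (\<beta> q) (x q)) d))) A
        = (\<Sum>y\<in>?h -` A. pmf ?p y)"
      by (simp add: measure_measure_pmf_finite)
    also have "\<dots> = (\<Sum>y\<in>UNIV. pmf ?p y * indicator A (?h y))"
      by (rule sum.mono_neutral_cong_left) (auto simp: indicator_def)
    finally show ?thesis
      by (simp only: sum.cartesian_product case_prod_unfold UNIV_Times_UNIV prod.collapse)
  qed
  \<comment> \<open>One factor counts the forwarding choices, the other the basis choices.\<close>
  have "(4 :: real) ^ CARD('l qubit) = 2 ^ CARD('l qubit) * 2 ^ CARD('l qubit)"
    by (simp flip: power_mult_distrib)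
  then show ?thesis
    unfolding P1_def prob_bind_pmf_of_set inner
    by (simp add: card_fun card_basis sum_divide_distrib flip: divide_divide_eq_left)
qed

text \<open>The exchange is averaged first, at fixed outcomes; the basis average follows once the
  outcomes are summed out. Division by \<open>4 ^ CARD('l qubit)\<close> is left to the
  caller.\<close>

lemma repudiation_moment:
  fixes \<rho> :: "complex ^ ('a::finite \<times> 'l::finite qubits_basis) ^ ('a \<times> 'l qubits_basis)"
    and K :: "'l bb84_declaration \<Rightarrow> complex ^ 'a ^ 'a"
  assumes "density_operator \<rho>" "measurement K"
  shows "(\<Sum>f\<in>UNIV. \<Sum>\<beta>\<in>UNIV. \<Sum>d\<in>UNIV. \<Sum>x\<in>UNIV. pmf (born (joint_measurement K \<beta>) \<rho>) (d, x) *
            exp (s * score (Transcript f (\<lambda>q. excluded_state (\<beta> q) (x q)) d)))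
         \<le> (2 * (cosh s + 1)) ^ CARD('l qubit)" (is "?lhs \<le> _")
proof -
  define p where "p \<beta> d x = pmf (born (joint_measurement K \<beta>) \<rho>) (d, x)" for \<beta> d x
  define w where "w d = Re (trace (tensor_op (dagger (K d) ** K d) (mat 1) ** \<rho>))" for d
  define G where "G \<beta> d = (\<Prod>q\<in>UNIV. if \<beta> q = basis_of (d (fst q)) then cosh s else 1)"
    for \<beta> :: "'l qubit \<Rightarrow> basis" and d
  have marginal: "(\<Sum>x\<in>UNIV. p \<beta> d x) = w d" for \<beta> d
    unfolding p_def w_def by (rule declaration_marginal[OF assms])
  have w_sum: "(\<Sum>d\<in>UNIV. w d) = 1"
  proof -
    \<comment> \<open>By no-signalling any basis assignment serves here, even
      \<open>undefined\<close>.\<close>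
    have "(\<Sum>d\<in>UNIV. w d) = (\<Sum>y\<in>UNIV. pmf (born (joint_measurement K undefined) \<rho>) y)"
      by (simp add: sum.cartesian_product p_def flip: marginal[of undefined])
    then show ?thesis by (simp add: sum_pmf_eq_1)
  qed
  let ?e = "\<lambda>\<beta> x q. excluded_state (\<beta> q) (x q)"
  have "?lhs = (\<Sum>\<beta>\<in>UNIV. \<Sum>d\<in>UNIV. \<Sum>x\<in>UNIV. p \<beta> d x * (\<Sum>f\<in>UNIV. exp (s * score (Transcript f (?e \<beta> x) d))))"
    unfolding p_def sum_distrib_left
    apply (subst sum.swap, rule sum.cong[OF refl])
    apply (subst sum.swap, rule sum.cong[OF refl])
    by (subst sum.swap, rule refl)
  also have "\<dots> \<le> (\<Sum>\<beta>\<in>UNIV. \<Sum>d\<in>UNIV. \<Sum>x\<in>UNIV. p \<beta> d x * (2 ^ CARD('l qubit) * G \<beta> d))"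
  proof (intro sum_mono mult_left_mono)
    fix \<beta> :: "'l qubit \<Rightarrow> basis" and d x
    \<comment> \<open>Basis agreement is necessary for a mismatch but not sufficient. As cosh is at
      least 1, replacing mismatch by agreement only enlarges the product, and makes it independent
      of \<open>x\<close>.\<close>
    have "(\<Prod>q\<in>UNIV. 2 * (if d (fst q) = ?e \<beta> x q then cosh s else 1))
        \<le> (\<Prod>q\<in>UNIV. 2 * (if \<beta> q = basis_of (d (fst q)) then cosh s else 1))"
      by (intro prod_mono)
         (auto simp: cosh_real_nonneg cosh_real_ge_1 basis_of_excluded_state)
    then show "(\<Sum>f\<in>UNIV. exp (s * score (Transcript f (?e \<beta> x) d))) \<le> 2 ^ CARD('l qubit) * G \<beta> d"
      unfolding score_exchange_moment by (simp add: prod.distrib G_def)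
  qed (simp add: p_def)
  \<comment> \<open>The sum over \<open>x\<close> collapses to \<open>w d\<close>, whose
    independence of \<open>\<beta>\<close> lets the basis sum act on \<open>G\<close> alone.\<close>
  also have "\<dots> = 2 ^ CARD('l qubit) * (\<Sum>d\<in>UNIV. w d * (\<Sum>\<beta>\<in>UNIV. G \<beta> d))"
    unfolding sum_distrib_right[symmetric] marginal
    by (subst sum.swap) (simp only: sum_distrib_left mult.left_commute)
  also have "\<dots> = (2 * (cosh s + 1)) ^ CARD('l qubit)"
    unfolding G_def basis_choice_moment
    by (simp only: w_sum power_mult_distrib mult_1_left flip: sum_distrib_right)
  finally show ?thesis .
qed

section \<open>The exponential Markov bound\<close>

theorem mainTheorem2:
  fixes \<rho> :: "complex ^ ('a::finite \<times> 'l::finite qubits_basis) ^ ('a \<times> 'l qubits_basis)"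
    and K :: "'l bb84_declaration \<Rightarrow> complex ^ 'a ^ 'a"
    and abort :: "nat \<Rightarrow> nat \<Rightarrow> bool"
    and s\<^sub>a s\<^sub>v :: real
  assumes "0 \<le> s\<^sub>a" and "s\<^sub>a < s\<^sub>v" and "s\<^sub>v < 1"
    and "density_operator \<rho>"
    and "measurement K"
  shows "measure_pmf.prob (P1 \<rho> K) {t. repudiation abort s\<^sub>a s\<^sub>v t}
           \<le> exp (- ((s\<^sub>v - s\<^sub>a)\<^sup>2 * real CARD('l) / 2))"
proof -
  \<comment> \<open>The gap also serves as moment parameter: with parameter t the exponent is
    \<open>L\<close> times t^2/2 - ts, minimal at t = \<open>s\<close>.\<close>
  define s where "s = s\<^sub>v - s\<^sub>a"
  have "s > 0" using assms by (simp add: s_def)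
  let ?T = "\<lambda>f \<beta> d x. Transcript f (\<lambda>q. excluded_state (\<beta> q) (x q)) d"
  let ?n = "CARD('l qubit)" and ?C = "exp (- (s\<^sup>2 * CARD('l)))"
  have markov: "indicator {t. repudiation abort s\<^sub>a s\<^sub>v t} t \<le> ?C * exp (s * score t)"
    for t :: "'l transcript"
  proof (cases "repudiation abort s\<^sub>a s\<^sub>v t")
    case True
    then have "s * (s * CARD('l)) \<le> s * score t"
      using repudiation_score[OF True] \<open>s > 0\<close> unfolding s_def by (intro mult_left_mono) auto
    then show ?thesis
      using True by (simp add: power2_eq_square mult_ac flip: exp_add)
  qed simp
  have "measure_pmf.prob (P1 \<rho> K) {t. repudiation abort s\<^sub>a s\<^sub>v t}
      \<le> (\<Sum>f\<in>UNIV. \<Sum>\<beta>\<in>UNIV. \<Sum>d\<in>UNIV. \<Sum>x\<in>UNIV. pmf (born (joint_measurement K \<beta>) \<rho>) (d, x) *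
          (?C * exp (s * score (?T f \<beta> d x)))) / 4 ^ ?n"
    unfolding prob_P1 by (intro divide_right_mono sum_mono mult_left_mono markov) auto
  also have "\<dots> = ?C * (\<Sum>f\<in>UNIV. \<Sum>\<beta>\<in>UNIV. \<Sum>d\<in>UNIV. \<Sum>x\<in>UNIV.
      pmf (born (joint_measurement K \<beta>) \<rho>) (d, x) * exp (s * score (?T f \<beta> d x))) / 4 ^ ?n"
    by (simp add: sum_distrib_left mult.left_commute)
  also have "\<dots> \<le> ?C * (2 * (cosh s + 1)) ^ ?n / 4 ^ ?n"
    by (intro divide_right_mono mult_left_mono repudiation_moment assms) auto
  also have "\<dots> \<le> ?C * (2 * (2 * exp (s\<^sup>2 / 4))) ^ ?n / 4 ^ ?n"
    by (intro divide_right_mono mult_left_mono power_mono cosh_plus_1_le)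
       (auto simp: cosh_real_nonneg add_nonneg_nonneg)
  also have "\<dots> = ?C * exp (s\<^sup>2 / 4) ^ ?n"
    by (simp add: power_mult_distrib)
  \<comment> \<open>There are two qubits per position, so half of the exponent of \<open>?C\<close>
    is cancelled.\<close>
  also have "\<dots> = exp (- (s\<^sup>2 * CARD('l) / 2))"
    unfolding card_qubit by (simp add: field_simps flip: exp_of_nat_mult exp_add)
  finally show ?thesis
    by (simp add: s_def)
qed

end
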